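(* Let $S=\langle a_1,\dots,a_n\rangle\subseteq\mathbb{N}^d$ be an MPD-semigroup, minimally generated by $a_1,\dots,a_n$. If $I_S$ is generic, then each $f\in\mathrm{PF}(S)$ has a unique RF-matrix $\mathrm{RF}(f)=(m_{ij})$, and $m_{ij}\neq m_{i'j}$ for all $i\neq i'$ (and all $j$).
   Context: $\mathbb{N}$ denotes the non-negative integers. An affine semigroup $S$ is a finitely generated submonoid of $\mathbb{N}^d$, with minimal generating set $\{a_1,\dots,a_n\}$. Put $\mathrm{cone}(S)=\{\sum_{i=1}^n\lambda_i a_i\mid \lambda_i\in\mathbb{Q}_{\ge 0}\}$ and $\mathcal{H}(S)=(\mathrm{cone}(S)\setminus S)\cap\mathbb{N}^d$. The set of pseudo-Frobenius elements is $\mathrm{PF}(S)=\{f\in\mathcal{H}(S)\mid f+s\in S \text{ for all } s\in S\setminus\{0\}\}$. $S$ is an MPD-semigroup if $\mathrm{PF}(S)\neq\emptyset$ (for $n\ge 2$ equivalently, the semigroup ring $k[S]$ has projective dimension $n-1$ over $k[x_1,\dots,x_n]$). For $f\in\mathrm{PF}(S)$, an RF-matrix (row-factorization matrix) of $f$ is an $n\times n$ integer matrix $M=(m_{ij})$ with $m_{ii}=-1$ for every $i$, $m_{ij}\in\mathbb{N}$ for $i\neq j$, and $\sum_{j=1}^n m_{ij}a_j=f$ for every $i$. For a field $k$, $I_S$ is the kernel of the $k$-algebra map $k[x_1,\dots,x_n]\to k[t_1,\dots,t_d]$, $x_i\mapsto\mathbf{t}^{a_i}$. A binomial $\mathbf{x}^u-\mathbf{x}^v$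 has full support if every variable $x_1,\dots,x_n$ occurs in $\mathbf{x}^u$ or $\mathbf{x}^v$. $I_S$ is generic if it has a minimal generating set consisting of binomials of full support. *)

theory Defs
  imports "HOL-Analysis.Finite_Cartesian_Product" "HOL-Library.Poly_Mapping"
begin

text \<open>
  The index types \<open>'n\<close> and \<open>'d\<close> play the roles of \<open>{1..n}\<close> and \<open>{1..d}\<close>, and a family
  \<open>a :: 'n \<Rightarrow> nat ^ 'd\<close> lists the generators of a submonoid of \<open>\<nat>^d\<close>.
\<close>

subsection \<open>Affine semigroups and pseudo-Frobenius elements\<close>

definition submonoid :: "'a::comm_monoid_add set \<Rightarrow> bool" where
  "submonoid M \<longleftrightarrow> 0 \<in> M \<and> (\<forall>x\<in>M. \<forall>y\<in>M. x + y \<in> M)"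

definition semigroup_of :: "('n \<Rightarrow> nat ^ 'd) \<Rightarrow> (nat ^ 'd) set" where
  "semigroup_of a = submonoid hull (range a)"

definition minimally_generating :: "('n \<Rightarrow> nat ^ 'd) \<Rightarrow> bool" where
  "minimally_generating a \<longleftrightarrow>
     inj a \<and> (\<forall>B. B \<subset> range a \<longrightarrow> submonoid hull B \<noteq> semigroup_of a)"

text \<open>Coordinatewise embedding of \<open>\<nat>^d\<close> into \<open>\<int>^d\<close> and \<open>\<rat>^d\<close>.\<close>

definition of_nat_vec :: "nat ^ 'd \<Rightarrow> 'r::semiring_1 ^ 'd" where
  "of_nat_vec v = (\<chi> k. of_nat (v $ k))"

definition rat_cone :: "('n::finite \<Rightarrow> nat ^ 'd) \<Rightarrow> (rat ^ 'd) set" where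
  "rat_cone a = {\<Sum>i\<in>UNIV. l i *s of_nat_vec (a i) | l. \<forall>i. 0 \<le> l i}"

definition gaps :: "('n::finite \<Rightarrow> nat ^ 'd) \<Rightarrow> (nat ^ 'd) set" where
  "gaps a = {h. of_nat_vec h \<in> rat_cone a \<and> h \<notin> semigroup_of a}"

definition PF :: "('n::finite \<Rightarrow> nat ^ 'd) \<Rightarrow> (nat ^ 'd) set" where
  "PF a = {f \<in> gaps a. \<forall>s \<in> semigroup_of a - {0}. f + s \<in> semigroup_of a}"

definition MPD_semigroup :: "('n::finite \<Rightarrow> nat ^ 'd) \<Rightarrow> bool" where
  "MPD_semigroup a \<longleftrightarrow> PF a \<noteq> {}"

definition RF_matrix :: "('n::finite \<Rightarrow> nat ^ 'd) \<Rightarrow> nat ^ 'd \<Rightarrow> int ^ 'n ^ 'n \<Rightarrow> bool" where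
  "RF_matrix a f M \<longleftrightarrow>
     (\<forall>i. M $ i $ i = - 1) \<and>
     (\<forall>i j. i \<noteq> j \<longrightarrow> 0 \<le> M $ i $ j) \<and>
     (\<forall>i. (\<Sum>j\<in>UNIV. M $ i $ j *s of_nat_vec (a j)) = of_nat_vec f)"

subsection \<open>Toric ideals\<close>

text \<open>
  The polynomial ring over \<open>'k\<close> in variables indexed by \<open>'n\<close> is the monoid algebra of \<open>\<nat>^n\<close>:
  \<open>Poly_Mapping.single u c\<close> is the term \<open>c x^u\<close>, and multiplication is convolution.
\<close>

type_synonym ('n, 'k) mpol = "(nat ^ 'n) \<Rightarrow>\<^sub>0 'k"

definition monomial :: "nat ^ 'n \<Rightarrow> ('n::finite, 'k::comm_ring_1) mpol" where
  "monomial u = Poly_Mapping.single u 1"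

text \<open>Substitution of \<open>t^(a i)\<close> for \<open>x_i\<close>; \<open>Poly_Mapping.single 0 c\<close> is the constant \<open>c\<close>.\<close>

definition toric_map ::
  "('n::finite \<Rightarrow> nat ^ 'd) \<Rightarrow> ('n, 'k::comm_ring_1) mpol \<Rightarrow> ('d::finite, 'k) mpol" where
  "toric_map a p =
     (\<Sum>u\<in>Poly_Mapping.keys p.
        Poly_Mapping.single 0 (Poly_Mapping.lookup p u) * (\<Prod>i\<in>UNIV. monomial (a i) ^ (u $ i)))"

definition toric_ideal ::
  "('n::finite \<Rightarrow> nat ^ 'd::finite) \<Rightarrow> ('n, 'k::comm_ring_1) mpol set" where
  "toric_ideal a = {p. toric_map a p = 0}"

text \<open>The ideal generated by a set: its span in the ring viewed as a module over itself.\<close>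

definition ideal_generated :: "'r::comm_ring_1 set \<Rightarrow> 'r set" where
  "ideal_generated G = module.span (*) G"

definition full_support_binomial :: "('n::finite, 'k::comm_ring_1) mpol \<Rightarrow> bool" where
  "full_support_binomial p \<longleftrightarrow>
     (\<exists>u v. u \<noteq> v \<and> p = monomial u - monomial v \<and> (\<forall>i. 0 < u $ i \<or> 0 < v $ i))"

definition generic_ideal :: "('n::finite, 'k::comm_ring_1) mpol set \<Rightarrow> bool" where
  "generic_ideal I \<longleftrightarrow>
     (\<exists>G. ideal_generated G = I \<and> (\<forall>H. H \<subset> G \<longrightarrow> ideal_generated H \<noteq> I) \<and>
          (\<forall>g\<in>G. full_support_binomial g))"

end

theory Submission
  imports Defs
begin

text \<open>
  A binomial \<open>x^u - x^v\<close> lies in the ideal generated by binomials \<open>x^p - x^q\<close> iff \<open>u\<close> and \<open>v\<close> are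
  joined by moves \<open>r + p \<leftrightarrow> r + q\<close>: the sum of the coefficients over a connected component is a
  linear functional vanishing on the ideal. So the factorizations of a fixed element of the
  semigroup are connected by the moves of the generators of the toric ideal.

  Row \<open>i\<close> of an RF-matrix of \<open>f\<close> is a factorization of \<open>f + a i\<close>. Since \<open>f\<close> is not in the
  semigroup, every such factorization avoids \<open>a i\<close>, so no full-support move connects two of them,
  and the row is unique. For rows \<open>i\<close> and \<open>i'\<close>, compare the two resulting factorizations of
  \<open>f + a i + a i'\<close>. A full-support move starting at the first leads to one that uses \<open>a i\<close>, hence
  by uniqueness to the second. They therefore differ by a single generator; its terms are coprime
  and together involve every variable, so the two factorizations differ in every coordinate.
\<close>

subsection \<open>Factorizations\<close>

text \<open>The degree of x^u in the grading of the polynomial ring by the semigroup; the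
  factorizations of \<open>s\<close> are the \<open>u\<close> with
  \<open>degree_of a u = s\<close>.\<close>

definition degree_of :: "('n::finite \<Rightarrow> nat ^ 'd) \<Rightarrow> nat ^ 'n \<Rightarrow> nat ^ 'd" where
  "degree_of a u = (\<Sum>i\<in>UNIV. u $ i *s a i)"

lemma degree_of_zero [simp]: "degree_of a 0 = 0"
  by (simp add: degree_of_def)

lemma degree_of_add: "degree_of a (u + v) = degree_of a u + degree_of a v"
  by (simp add: degree_of_def sum.distrib vec_eq_iff algebra_simps)

lemma degree_of_axis [simp]: "degree_of a (axis i 1) = a i"
proof -
  have "degree_of a (axis i 1) = (\<Sum>j\<in>UNIV. if j = i then a j else 0)"
    unfolding degree_of_def by (rule sum.cong) (auto simp: axis_def vec_eq_iff)
  then show ?thesis by simp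
qed

lemmas degree_of_axis_Suc [simp] = degree_of_axis[unfolded One_nat_def]

lemma pos_component_axis:
  fixes u :: "nat ^ 'n::finite"
  assumes "0 < u $ i"
  obtains v where "u = axis i 1 + v"
proof
  show "u = axis i 1 + (\<chi> k. if k = i then u $ k - 1 else u $ k)"
    using assms by (auto simp: axis_def vec_eq_iff)
qed

lemma semigroup_of_eq_range: "semigroup_of a = range (degree_of a)"
proof (rule equalityI)
  have "submonoid (range (degree_of a))"
    unfolding submonoid_def by (auto simp: image_iff) (metis degree_of_zero, metis degree_of_add)
  moreover have "range a \<subseteq> range (degree_of a)"
    by (metis degree_of_axis image_subsetI rangeI)
  ultimately show "semigroup_of a \<subseteq> range (degree_of a)"
    unfolding semigroup_of_def by (simp add: hull_minimal)
next
  have "degree_of a u \<in> M" if M: "submonoid M" "range a \<subseteq> M" for u M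
  proof -
    have "m *s a i \<in> M" for m i
    proof (induction m)
      case 0
      then show ?case using M by (simp add: submonoid_def)
    next
      case (Suc m)
      have "Suc m *s a i = a i + m *s a i" by (simp add: vec_eq_iff)
      then show ?case using M Suc by (auto simp: submonoid_def)
    qed
    then have "(\<Sum>i\<in>A. u $ i *s a i) \<in> M" for A
      using M by (induction A rule: infinite_finite_induct) (auto simp: submonoid_def)
    then show ?thesis by (simp add: degree_of_def)
  qed
  then show "range (degree_of a) \<subseteq> semigroup_of a"
    by (auto simp: semigroup_of_def hull_def)
qed

text \<open>Every submonoid contains 0, so a zero generator could be dropped.\<close>

lemma minimally_generating_nonzero:
  assumes "minimally_generating a"
  shows "a i \<noteq> 0"
proof
  assume i: "a i = 0"
  have "0 \<in> submonoid hull (range a - {0})"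
    by (auto simp: hull_def submonoid_def)
  then have "submonoid hull (insert 0 (range a - {0})) = submonoid hull (range a - {0})"
    by (rule hull_redundant)
  moreover have "insert 0 (range a - {0}) = range a"
    using i by (metis insert_Diff rangeI)
  ultimately have "submonoid hull (range a - {0}) = semigroup_of a"
    by (simp add: semigroup_of_def)
  moreover have "range a - {0} \<subset> range a"
    using i by (metis Diff_subset Diff_iff insertI1 psubsetI rangeI)
  ultimately show False
    using assms by (simp add: minimally_generating_def)
qed

subsection \<open>Binomial ideals and connected components\<close>

definition binomial_of :: "(nat ^ 'n) \<times> (nat ^ 'n) \<Rightarrow> ('n::finite, 'k::comm_ring_1) mpol" where
  "binomial_of z = monomial (fst z) - monomial (snd z)"

text \<open>One step of binomial rewriting: the pair stands for x^p - x^q and \<open>r\<close> for a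
  common monomial factor. Allowing both orientations makes the relation symmetric, so its reflexive
  transitive closure is an equivalence.\<close>

definition move :: "((nat ^ 'n) \<times> (nat ^ 'n)) set \<Rightarrow> nat ^ 'n \<Rightarrow> nat ^ 'n \<Rightarrow> bool" where
  "move P w w' \<longleftrightarrow>
     (\<exists>r p q. ((p, q) \<in> P \<or> (q, p) \<in> P) \<and> w = r + p \<and> w' = r + q)"

lemma monomial_add: "monomial (u + v) = monomial u * monomial v"
  by (simp add: monomial_def mult_single)

section \<open>Ideals as spans and their closure properties\<close>

lemma module_self: "module ((*) :: 'r::comm_ring_1 \<Rightarrow> 'r \<Rightarrow> 'r)"
  by unfold_locales (simp_all add: algebra_simps)

lemma ideal_generated_minus:
  "x \<in> ideal_generated G \<Longrightarrow> y \<in> ideal_generated G \<Longrightarrow> x - y \<in> ideal_generated G"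
  unfolding ideal_generated_def by (rule module.span_diff[OF module_self])

lemma ideal_generated_add:
  "x \<in> ideal_generated G \<Longrightarrow> y \<in> ideal_generated G \<Longrightarrow> x + y \<in> ideal_generated G"
  unfolding ideal_generated_def by (rule module.span_add[OF module_self])

lemma ideal_generated_mult: "x \<in> ideal_generated G \<Longrightarrow> c * x \<in> ideal_generated G"
  unfolding ideal_generated_def by (rule module.span_scale[OF module_self])

lemma ideal_generated_zero: "0 \<in> ideal_generated G"
  unfolding ideal_generated_def by (rule module.span_zero[OF module_self])

lemma ideal_generated_base: "x \<in> G \<Longrightarrow> x \<in> ideal_generated G"
  unfolding ideal_generated_def by (rule module.span_base[OF module_self])

lemma ideal_generated_redundant:
  "x \<in> ideal_generated G \<Longrightarrow> ideal_generated (insert x G) = ideal_generated G"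
  unfolding ideal_generated_def module.span_eq[OF module_self]
  using module.span_superset[OF module_self] by blast

section \<open>Linear functionals given by their values on monomials\<close>

definition weighted_sum :: "('a \<Rightarrow> 'k::comm_ring_1) \<Rightarrow> ('a \<Rightarrow>\<^sub>0 'k) \<Rightarrow> 'k" where
  "weighted_sum \<phi> p = (\<Sum>u\<in>Poly_Mapping.keys p. Poly_Mapping.lookup p u * \<phi> u)"

lemma weighted_sum_superset:
  assumes "finite A" "Poly_Mapping.keys p \<subseteq> A"
  shows "weighted_sum \<phi> p = (\<Sum>u\<in>A. Poly_Mapping.lookup p u * \<phi> u)"
  unfolding weighted_sum_def
  by (rule sum.mono_neutral_left) (use assms in \<open>auto simp: in_keys_iff\<close>)

lemma weighted_sum_zero [simp]: "weighted_sum \<phi> 0 = 0"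
  by (simp add: weighted_sum_def)

lemma weighted_sum_single [simp]: "weighted_sum \<phi> (Poly_Mapping.single u c) = c * \<phi> u"
  by (simp add: weighted_sum_def)

lemma weighted_sum_add:
  "weighted_sum \<phi> (p + q) = weighted_sum \<phi> p + weighted_sum \<phi> q"
proof -
  let ?A = "Poly_Mapping.keys p \<union> Poly_Mapping.keys q"
  have "Poly_Mapping.keys (p + q) \<subseteq> ?A" by (rule keys_add)
  then show ?thesis
    by (simp add: weighted_sum_superset[of ?A] lookup_add sum.distrib algebra_simps)
qed

lemma weighted_sum_diff:
  "weighted_sum \<phi> (p - q) = weighted_sum \<phi> p - weighted_sum \<phi> q"
  using weighted_sum_add[of \<phi> "p - q" q] by simp

text \<open>By additivity in \<open>r\<close> only a single term c x^w matters, and there the value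
  is c times the difference of \<open>\<phi> (w + p)\<close> and
  \<open>\<phi> (w + q)\<close>.\<close>

lemma weighted_sum_mult_binomial:
  fixes r :: "('n::finite, 'k::comm_ring_1) mpol"
  assumes "\<And>w. \<phi> (w + p) = \<phi> (w + q)"
  shows "weighted_sum \<phi> (r * binomial_of (p, q)) = 0"
proof (induction r rule: update_induct)
  case const
  then show ?case by simp
next
  case (update r w c)
  have "Poly_Mapping.update w c r = Poly_Mapping.single w c + r"
    using update(1) by (intro poly_mapping_eqI)
      (auto simp: lookup_update lookup_add lookup_single in_keys_iff when_def)
  moreover have "weighted_sum \<phi> (Poly_Mapping.single w c * binomial_of (p, q)) = 0"
    by (simp add: binomial_of_def monomial_def right_diff_distrib mult_single
        weighted_sum_diff assms)
  ultimately show ?case using update by (simp add: distrib_right weighted_sum_add)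
qed

text \<open>With \<phi> the indicator of the component of \<open>u\<close>, the functional vanishes
  on the ideal; its value on x^u - x^v is \<open>1 - \<phi> v\<close>, which forces \<open>v\<close>
  into that component.\<close>

lemma binomial_mem_ideal_imp_connected:
  fixes P :: "((nat ^ 'n::finite) \<times> (nat ^ 'n)) set"
  assumes "(binomial_of (u, v) :: ('n, 'k::comm_ring_1) mpol) \<in> ideal_generated (binomial_of ` P)"
  shows "(move P)\<^sup>*\<^sup>* u v"
proof -
  define \<phi> :: "nat ^ 'n \<Rightarrow> 'k" where "\<phi> w = of_bool ((move P)\<^sup>*\<^sup>* u w)" for w
  have inv: "\<phi> (w + p) = \<phi> (w + q)" if "(p, q) \<in> P" for w p q
  proof -
    have "move P (w + p) (w + q)" "move P (w + q) (w + p)"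
      using that by (auto simp: move_def)
    then have "(move P)\<^sup>*\<^sup>* u (w + p) \<longleftrightarrow> (move P)\<^sup>*\<^sup>* u (w + q)"
      by (blast intro: rtranclp.rtrancl_into_rtrancl)
    then show ?thesis by (simp add: \<phi>_def)
  qed
  have "weighted_sum \<phi> x = 0"
    if "x \<in> ideal_generated (binomial_of ` P)" for x :: "('n, 'k) mpol"
    using that unfolding ideal_generated_def
  proof (induction rule: module.span_induct_alt[OF module_self, consumes 1])
    case 1
    then show ?case by simp
  next
    case (2 c x y)
    then obtain p q where "(p, q) \<in> P" "x = binomial_of (p, q)" by auto
    then show ?case
      using 2 weighted_sum_mult_binomial[of \<phi> p q c] inv by (simp add: weighted_sum_add)
  qed
  from this[OF assms] have "\<phi> u = \<phi> v"
    by (simp add: binomial_of_def monomial_def weighted_sum_diff)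
  then show ?thesis
    by (cases "(move P)\<^sup>*\<^sup>* u v") (simp_all add: \<phi>_def)
qed

text \<open>A path telescopes: x^u - x^v is the sum of the binomials of its moves, each a monomial
  times a generator up to sign.\<close>

lemma connected_imp_binomial_mem_ideal:
  fixes P :: "((nat ^ 'n::finite) \<times> (nat ^ 'n)) set"
  assumes "(move P)\<^sup>*\<^sup>* u v"
  shows "(binomial_of (u, v) :: ('n, 'k::comm_ring_1) mpol) \<in> ideal_generated (binomial_of ` P)"
  using assms
proof (induction rule: rtranclp_induct)
  case base
  then show ?case by (simp add: binomial_of_def ideal_generated_zero)
next
  case (step w w')
  from step(2) obtain r p q
    where rpq: "(p, q) \<in> P \<or> (q, p) \<in> P" "w = r + p" "w' = r + q"
    by (auto simp: move_def)
  let ?I = "ideal_generated (binomial_of ` P) :: ('n, 'k) mpol set"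
  have "binomial_of (w, w') = monomial r * (binomial_of (p, q) :: ('n, 'k) mpol)"
    using rpq by (simp add: binomial_of_def monomial_add right_diff_distrib)
  moreover have "binomial_of (p, q) \<in> ?I"
    using rpq(1)
  proof
    assume "(q, p) \<in> P"
    then have "binomial_of (q, p) \<in> ?I" by (intro ideal_generated_base imageI)
    from ideal_generated_minus[OF ideal_generated_zero this] show ?thesis
      by (simp add: binomial_of_def)
  qed (intro ideal_generated_base imageI)
  ultimately have "binomial_of (w, w') \<in> ?I" by (simp add: ideal_generated_mult)
  from ideal_generated_add[OF step.IH this] show ?case by (simp add: binomial_of_def)
qed

text \<open>Distinct monomials do not cancel, so both have nonzero coefficients. Order is not
  recovered: in characteristic 2 a binomial equals its reverse.\<close>

lemma binomial_of_eqD: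
  assumes "binomial_of (x, y) = (binomial_of (p, q) :: ('n::finite, 'k::comm_ring_1) mpol)" "x \<noteq> y"
  shows "x \<in> {p, q}" "y \<in> {p, q}"
proof -
  have "Poly_Mapping.lookup (binomial_of (p, q) :: ('n, 'k) mpol) x \<noteq> 0"
    "Poly_Mapping.lookup (binomial_of (p, q) :: ('n, 'k) mpol) y \<noteq> 0"
    unfolding assms(1)[symmetric] using assms(2)
    by (auto simp: binomial_of_def monomial_def lookup_minus lookup_single when_def)
  then show "x \<in> {p, q}" "y \<in> {p, q}"
    by (auto simp: binomial_of_def monomial_def lookup_minus lookup_single when_def split: if_splits)
qed

subsection \<open>Toric ideals\<close>

lemma monomial_power: "monomial v ^ m = monomial (m *s v)"
proof (induction m)
  case 0
  have "0 *s v = 0" by (simp add: vec_eq_iff)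
  then show ?case by (simp add: monomial_def)
next
  case (Suc m)
  have "Suc m *s v = v + m *s v" by (simp add: vec_eq_iff)
  then show ?case by (simp add: Suc monomial_add)
qed

lemma prod_monomial: "(\<Prod>i\<in>A. monomial (f i)) = monomial (\<Sum>i\<in>A. f i)"
proof (induction A rule: infinite_finite_induct)
  case (insert x F)
  then show ?case by (simp add: monomial_add)
qed (simp_all add: monomial_def)

lemma toric_map_alt:
  "toric_map a p =
    (\<Sum>u\<in>Poly_Mapping.keys p. Poly_Mapping.single (degree_of a u) (Poly_Mapping.lookup p u))"
  unfolding toric_map_def monomial_power prod_monomial degree_of_def[symmetric]
  by (simp add: monomial_def mult_single)

lemma toric_map_binomial_of:
  "toric_map a (binomial_of (u, v) :: ('n::finite, 'k::comm_ring_1) mpol) =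
    binomial_of (degree_of a u, degree_of a v)"
proof (cases "u = v")
  case False
  let ?b = "binomial_of (u, v) :: ('n, 'k) mpol"
  have "Poly_Mapping.keys ?b = {u, v}"
    using False
    by (auto simp: in_keys_iff binomial_of_def monomial_def lookup_minus lookup_single when_def
        split: if_splits)
  then show ?thesis
    using False
    by (simp add: toric_map_alt binomial_of_def monomial_def lookup_minus lookup_single when_def
        single_uminus)
qed (simp add: binomial_of_def toric_map_alt)

lemma binomial_of_mem_toric_ideal_iff:
  "(binomial_of (u, v) :: ('n::finite, 'k::comm_ring_1) mpol) \<in> toric_ideal a \<longleftrightarrow>
    degree_of a u = degree_of a v"
proof -
  have "binomial_of (x, y) = (0 :: ('d::finite, 'k) mpol) \<longleftrightarrow> x = y" for x y
  proof
    assume "binomial_of (x, y) = (0 :: ('d::finite, 'k) mpol)"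
    then have "binomial_of (x, y) = (binomial_of (x, x) :: ('d::finite, 'k) mpol)"
      by (simp add: binomial_of_def)
    from binomial_of_eqD(2)[OF this] show "x = y" by auto
  qed (simp add: binomial_of_def)
  then show ?thesis by (simp add: toric_ideal_def toric_map_binomial_of)
qed

text \<open>
  The last property is the coprimality of the two terms of a minimal generator: dividing by a
  common variable would give a binomial of the ideal in a smaller degree.
\<close>

lemma generic_toric_ideal_moves:
  fixes a :: "'n::finite \<Rightarrow> nat ^ 'd::finite"
  assumes nz: "\<And>i. a i \<noteq> 0"
    and gen: "generic_ideal (toric_ideal a :: ('n, 'k::comm_ring_1) mpol set)"
  obtains P where
    "\<And>u v. degree_of a u = degree_of a v \<longleftrightarrow> (move P)\<^sup>*\<^sup>* u v"
    "\<And>p q i. (p, q) \<in> P \<Longrightarrow> 0 < p $ i \<or> 0 < q $ i"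
    "\<And>p q i. (p, q) \<in> P \<Longrightarrow> p $ i = 0 \<or> q $ i = 0"
proof -
  from gen obtain G :: "('n, 'k) mpol set" where
    G: "ideal_generated G = toric_ideal a"
      "\<And>H. H \<subset> G \<Longrightarrow> ideal_generated H \<noteq> toric_ideal a"
      "\<And>g. g \<in> G \<Longrightarrow> full_support_binomial g"
    unfolding generic_ideal_def by blast
  define P where "P = {(p, q). (binomial_of (p, q) :: ('n, 'k) mpol) \<in> G \<and> p \<noteq> q \<and>
    (\<forall>i. 0 < p $ i \<or> 0 < q $ i)}"
  have GP: "G = binomial_of ` P"
  proof
    show "G \<subseteq> binomial_of ` P"
    proof
      fix g assume g: "g \<in> G"
      from G(3)[OF g] obtain p q where pq: "p \<noteq> q" "g = monomial p - monomial q"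
        "\<forall>i. 0 < p $ i \<or> 0 < q $ i"
        unfolding full_support_binomial_def by blast
      have "g = binomial_of (p, q)" using pq by (simp add: binomial_of_def)
      then show "g \<in> binomial_of ` P" using pq g unfolding P_def by blast
    qed
  qed (auto simp: P_def)
  have deg: "degree_of a u = degree_of a v \<longleftrightarrow> (move P)\<^sup>*\<^sup>* u v" for u v
    unfolding binomial_of_mem_toric_ideal_iff[where 'k = 'k, symmetric] G(1)[symmetric] GP
    using binomial_mem_ideal_imp_connected connected_imp_binomial_mem_ideal by blast
  have "p $ j = 0 \<or> q $ j = 0" if pq: "(p, q) \<in> P" for p q j
  proof (rule ccontr)
    assume "\<not> ?thesis"
    then obtain p' q' where p': "p = axis j 1 + p'" and q': "q = axis j 1 + q'"
      by (metis pos_component_axis neq0_conv)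
    define g :: "('n, 'k) mpol" where "g = binomial_of (p, q)"
    \<comment> \<open>Removing every pair that represents \<open>g\<close>, not only
      \<open>(p, q)\<close>, makes the remaining pairs match \<open>G - {g}\<close> exactly.\<close>
    define P' where "P' = {z \<in> P. (binomial_of z :: ('n, 'k) mpol) \<noteq> g}"
    have GP': "G - {g} = binomial_of ` P'"
      unfolding GP P'_def by auto
    have gG: "g \<in> G" using pq unfolding GP g_def by blast
    have "(move P)\<^sup>*\<^sup>* p q"
      using pq by (metis move_def add_0 r_into_rtranclp)
    then have dpq: "degree_of a p = degree_of a q" by (simp add: deg)
    then have "degree_of a p' = degree_of a q'" by (simp add: p' q' degree_of_add)
    then have "(move P)\<^sup>*\<^sup>* p' q'" by (simp add: deg)
    then have "(move P')\<^sup>*\<^sup>* p' q'"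
    proof (induction rule: rtranclp_induct)
      case (step w w')
      from step(2) obtain r x y
        where rxy: "(x, y) \<in> P \<or> (y, x) \<in> P" "w = r + x" "w' = r + y"
        by (auto simp: move_def)
      have "degree_of a w = degree_of a p'" using step(1) deg by metis
      then have "degree_of a r $ k + a j $ k + degree_of a x $ k = degree_of a p $ k" for k
        by (simp add: rxy(2) p' degree_of_add add_ac flip: vector_add_component)
      moreover obtain k where "a j $ k \<noteq> 0"
        using nz[of j] by (auto simp: vec_eq_iff)
      ultimately have "degree_of a x \<noteq> degree_of a p"
        by (metis add_cancel_right_left add_is_0)
      then have "x \<notin> {p, q}" using dpq by auto
      then have "binomial_of (x, y) \<noteq> g" if "(x, y) \<in> P"
        using that binomial_of_eqD(1)[where 'k = 'k, of x y p q] by (auto simp: g_def P_def)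
      moreover have "binomial_of (y, x) \<noteq> g" if "(y, x) \<in> P"
        using that \<open>x \<notin> {p, q}\<close> binomial_of_eqD(2)[where 'k = 'k, of y x p q]
        by (auto simp: g_def P_def)
      ultimately have "move P' w w'"
        using rxy unfolding move_def P'_def by blast
      then show ?case using step by simp
    qed simp
    then have "(binomial_of (p', q') :: ('n, 'k) mpol) \<in> ideal_generated (G - {g})"
      unfolding GP' by (rule connected_imp_binomial_mem_ideal)
    \<comment> \<open>Multiplying by the variable x_j restores \<open>g\<close>, which is therefore
      redundant in \<open>G\<close>.\<close>
    then have "monomial (axis j 1) * binomial_of (p', q') \<in> ideal_generated (G - {g})"
      by (rule ideal_generated_mult)
    moreover have "monomial (axis j 1) * binomial_of (p', q') = g"
      by (simp add: g_def p' q' binomial_of_def monomial_add right_diff_distrib)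
    ultimately have "ideal_generated (insert g (G - {g})) = ideal_generated (G - {g})"
      by (metis ideal_generated_redundant)
    then have "ideal_generated (G - {g}) = toric_ideal a"
      using gG G(1) by (simp add: insert_absorb)
    then show False using G(2)[of "G - {g}"] gG by blast
  qed
  moreover have "0 < p $ i \<or> 0 < q $ i" if "(p, q) \<in> P" for p q i
    using that by (auto simp: P_def)
  ultimately show ?thesis using that deg by blast
qed

subsection \<open>Row factorizations\<close>

text \<open>Adding 1 on the diagonal turns row \<open>i\<close> into a factorization
  \<open>U i\<close> of \<open>f + a i\<close> that avoids \<open>a i\<close>.\<close>

lemma RF_matrix_iff:
  fixes a :: "'n::finite \<Rightarrow> nat ^ 'd::finite"
  shows "RF_matrix a f M \<longleftrightarrow>
    (\<exists>U. (\<forall>i. U i $ i = 0 \<and> degree_of a (U i) = f + a i) \<and>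
      M = (\<chi> i j. int (U i $ j) - (if i = j then 1 else 0)))"
proof -
  have row: "(\<Sum>j\<in>UNIV. (int (u $ j) - (if i = j then 1 else 0)) *s of_nat_vec (a j))
      = (of_nat_vec f :: int ^ 'd) \<longleftrightarrow> degree_of a u = f + a i" for u i
  proof -
    have "(\<Sum>j\<in>UNIV. (int (u $ j) - (if i = j then 1 else 0)) * int (a j $ k))
        = int (degree_of a u $ k) - int (a i $ k)" for k
      by (simp add: degree_of_def left_diff_distrib sum_subtractf if_distrib[of "\<lambda>x. x * _"]
          cong: if_cong)
    then show ?thesis
      by (auto simp: vec_eq_iff of_nat_vec_def diff_eq_eq simp flip: of_nat_add)
  qed
  show ?thesis
  proof
    assume M: "RF_matrix a f M"
    define U where "U i = (\<chi> j. nat (M $ i $ j + (if i = j then 1 else 0)))" for i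
    have nonneg: "0 \<le> M $ i $ j + (if i = j then 1 else 0)" for i j
      using M by (auto simp: RF_matrix_def)
    have eq: "M = (\<chi> i j. int (U i $ j) - (if i = j then 1 else 0))"
      using nonneg by (simp add: U_def vec_eq_iff)
    have "U i $ i = 0" for i using M by (simp add: U_def RF_matrix_def)
    moreover have "degree_of a (U i) = f + a i" for i
    proof -
      have "(\<Sum>j\<in>UNIV. M $ i $ j *s of_nat_vec (a j)) = (of_nat_vec f :: int ^ 'd)"
        using M by (simp add: RF_matrix_def)
      then show ?thesis by (subst (asm) eq) (simp add: row)
    qed
    ultimately show "\<exists>U. (\<forall>i. U i $ i = 0 \<and> degree_of a (U i) = f + a i) \<and>
      M = (\<chi> i j. int (U i $ j) - (if i = j then 1 else 0))"
      using eq by blast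
  next
    assume "\<exists>U. (\<forall>i. U i $ i = 0 \<and> degree_of a (U i) = f + a i) \<and>
      M = (\<chi> i j. int (U i $ j) - (if i = j then 1 else 0))"
    then show "RF_matrix a f M"
      by (auto simp: RF_matrix_def row)
  qed
qed

section \<open>Uniqueness of the rows and their difference in every column\<close>

theorem theorem6p6:
  fixes a :: "'n::finite \<Rightarrow> nat ^ 'd::finite"
  assumes "minimally_generating a"
    and "MPD_semigroup a"
    and "generic_ideal (toric_ideal a :: ('n, 'k::field) mpol set)"
  shows "\<forall>f \<in> PF a. (\<exists>!M. RF_matrix a f M) \<and>
           (\<forall>M. RF_matrix a f M \<longrightarrow> (\<forall>i i' j. i \<noteq> i' \<longrightarrow> M $ i $ j \<noteq> M $ i' $ j))"
proof
  fix f assume f: "f \<in> PF a"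
  have nz: "a i \<noteq> 0" for i by (rule minimally_generating_nonzero[OF assms(1)])
  obtain P where
    deg: "\<And>u v. degree_of a u = degree_of a v \<longleftrightarrow> (move P)\<^sup>*\<^sup>* u v" and
    full: "\<And>p q i. (p, q) \<in> P \<Longrightarrow> 0 < p $ i \<or> 0 < q $ i" and
    coprime: "\<And>p q i. (p, q) \<in> P \<Longrightarrow> p $ i = 0 \<or> q $ i = 0"
    by (rule generic_toric_ideal_moves[OF nz assms(3)]) (blast intro: that)
  \<comment> \<open>A path between distinct factorizations is nonempty; only its first move is kept,
    and moves preserve the degree.\<close>
  have first_step: "\<exists>r p q. ((p, q) \<in> P \<or> (q, p) \<in> P) \<and> u = r + p \<and>
      degree_of a (r + q) = degree_of a u"
    if "degree_of a u = degree_of a v" "u \<noteq> v" for u v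
  proof -
    have "(move P)\<^sup>*\<^sup>* u v" using that deg by blast
    with \<open>u \<noteq> v\<close> obtain w where w: "move P u w" by (metis converse_rtranclpE)
    then have "degree_of a u = degree_of a w" using deg by blast
    with w show ?thesis by (auto simp: move_def)
  qed
  have notin: "f \<notin> range (degree_of a)"
    using f by (simp add: PF_def gaps_def semigroup_of_eq_range)
  \<comment> \<open>Deleting one \<open>a i\<close> from \<open>u\<close> would leave a
    factorization of \<open>f\<close>.\<close>
  have zero: "u $ i = 0" if "degree_of a u = f + a i" for u i
  proof (rule ccontr)
    assume "u $ i \<noteq> 0"
    then obtain v where "u = axis i 1 + v" by (metis pos_component_axis neq0_conv)
    with that have "a i + degree_of a v = a i + f" by (simp add: degree_of_add add.commute)
    then have "degree_of a v = f" by (simp only: add_left_cancel)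
    with notin show False by blast
  qed
  have unique: "u = v" if u: "degree_of a u = f + a i" and v: "degree_of a v = f + a i" for u v i
  proof (rule ccontr)
    assume "u \<noteq> v"
    with first_step[of u v] u v obtain r p q where
      rpq: "(p, q) \<in> P \<or> (q, p) \<in> P" "u = r + p" "degree_of a (r + q) = f + a i"
      by metis
    \<comment> \<open>Both ends of the move factor \<open>f + a i\<close>, so both avoid index
      \<open>i\<close>, which full support forbids.\<close>
    have "p $ i = 0" "q $ i = 0" using zero[OF u] zero[OF rpq(3)] rpq(2) by auto
    with full rpq(1) show False by (metis less_irrefl)
  qed
  have "\<exists>u. degree_of a u = f + a i" for i
  proof -
    have "a i \<in> semigroup_of a" by (metis semigroup_of_eq_range degree_of_axis rangeI)
    then have "f + a i \<in> semigroup_of a" using f nz by (simp add: PF_def)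
    then show ?thesis by (metis semigroup_of_eq_range imageE)
  qed
  then obtain U where U: "\<And>i. degree_of a (U i) = f + a i" by metis
  have RF: "RF_matrix a f M \<longleftrightarrow> M = (\<chi> i j. int (U i $ j) - (if i = j then 1 else 0))" for M
  proof -
    have "(\<forall>i. V i $ i = 0 \<and> degree_of a (V i) = f + a i) \<longleftrightarrow> V = U" for V
      using U zero unique by (metis ext)
    then show ?thesis by (simp add: RF_matrix_iff)
  qed
  have distinct: "U i $ j \<noteq> U i' $ j" if "i \<noteq> i'" "j \<noteq> i" "j \<noteq> i'" for i i' j
  proof
    assume eq: "U i $ j = U i' $ j"
    \<comment> \<open>Two factorizations of the same element; away from \<open>i\<close> and
      \<open>i'\<close> their coordinates are those of \<open>U i\<close> and
      \<open>U i'\<close>.\<close>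
    let ?u = "axis i' 1 + U i" and ?v = "axis i 1 + U i'"
    have ui: "?u $ i = 0" using \<open>i \<noteq> i'\<close> zero[OF U] by (simp add: axis_def)
    moreover have "?v $ i \<noteq> 0" by (simp add: axis_def)
    ultimately have "?u \<noteq> ?v" by metis
    moreover have "degree_of a ?u = f + a i + a i'" "degree_of a ?v = f + a i + a i'"
      by (simp_all add: degree_of_add U add_ac)
    ultimately obtain r p q where
      rpq: "(p, q) \<in> P \<or> (q, p) \<in> P" "?u = r + p" "degree_of a (r + q) = f + a i + a i'"
      using first_step[of ?u ?v] by metis
    \<comment> \<open>Variable \<open>i\<close> is missing from \<open>?u\<close>, hence from
      \<open>p\<close>; full support puts it into \<open>q\<close>, so one \<open>a i\<close> splits
      off from \<open>r + q\<close>.\<close>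
    have "p $ i = 0" using ui unfolding rpq(2) by simp
    then have "0 < (r + q) $ i" using full rpq(1) by (metis add_gr_0 less_irrefl vector_add_component)
    then obtain w where w: "r + q = axis i 1 + w" by (rule pos_component_axis)
    have "a i + degree_of a w = a i + (f + a i')"
      using rpq(3) unfolding w by (simp add: degree_of_add add_ac)
    then have "degree_of a w = f + a i'" by (simp only: add_left_cancel)
    \<comment> \<open>The remainder factors \<open>f + a i'\<close> and so equals
      \<open>U i'\<close>: a single move leads from \<open>?u\<close> to \<open>?v\<close>.\<close>
    then have "r + q = ?v" using w unique U by metis
    then have "(r + q) $ j = U i' $ j" using that by (simp add: axis_def)
    moreover have "(r + p) $ j = U i $ j" unfolding rpq(2)[symmetric] using that by (simp add: axis_def)
    ultimately have "p $ j = q $ j" using eq by simp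
    with full coprime rpq(1) show False by (metis less_irrefl)
  qed
  show "(\<exists>!M. RF_matrix a f M) \<and>
    (\<forall>M. RF_matrix a f M \<longrightarrow> (\<forall>i i' j. i \<noteq> i' \<longrightarrow> M $ i $ j \<noteq> M $ i' $ j))"
  proof (intro conjI allI impI)
    show "\<exists>!M. RF_matrix a f M" unfolding RF by simp
    fix M and i i' j :: 'n
    assume M: "RF_matrix a f M" and "i \<noteq> i'"
    have entry: "M $ k $ l = int (U k $ l) - (if k = l then 1 else 0)" for k l
      using M by (simp add: RF)
    have "U k $ k = 0" for k by (rule zero[OF U])
    then show "M $ i $ j \<noteq> M $ i' $ j"
      using \<open>i \<noteq> i'\<close> distinct[of i i' j] by (cases "j = i"; cases "j = i'") (auto simp: entry)
  qed
qed

end
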